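(* Let $\alpha,\beta,\gamma:\mathbb{R}^2\to\mathbb{R}$ and let $\psi$ be the bicomplex wave function $\psi(x,t)=\mathrm{e}^{\alpha(x,t)+\beta(x,t)\mathbf{i_1}+\gamma(x,t)\mathbf{i_2}}=\psi_+(x,t)\,\mathbf{e_1}+\psi_-(x,t)\,\mathbf{e_2}$, with $\psi_\pm$ valued in $\mathbb{C}(\mathbf{i_1})$. Then $$|\psi|^2=|\psi|_{\mathbf{1}}^2=|\psi|_{\mathbf{2}}^2=|\psi|_{\mathbf{3}}^2=\sqrt{\psi\psi^{\dag_1}\psi^{\dag_2}\psi^{\dag_3}}=\frac{|\psi_+|^2+|\psi_-|^2}{2}=\mathrm{e}^{2\alpha},$$ so that $|\psi|^2$ gives the standard Born formula $\mathrm{e}^{2\alpha}$, and $|\psi|^2$ is invariant under all the discrete symmetries $\hat P_0,\dots,\hat P_7$ of the bicomplex Schrödinger equation, i.e. $|\hat P_n\psi|^2=|\psi|^2$ for $n=0,\dots,7$.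
   Context: The bicomplex numbers are the commutative ring $\mathbb{T}=\{w_0+w_1\mathbf{i_1}+w_2\mathbf{i_2}+w_3\mathbf{j}: w_0,\dots,w_3\in\mathbb{R}\}$ with $\mathbf{i_1}^2=\mathbf{i_2}^2=-1$, $\mathbf{j}^2=1$, $\mathbf{i_1}\mathbf{i_2}=\mathbf{i_2}\mathbf{i_1}=\mathbf{j}$, $\mathbf{i_1}\mathbf{j}=\mathbf{j}\mathbf{i_1}=-\mathbf{i_2}$, $\mathbf{i_2}\mathbf{j}=\mathbf{j}\mathbf{i_2}=-\mathbf{i_1}$. For $k=1,2$, $\mathbb{C}(\mathbf{i_k})=\{x+y\mathbf{i_k}:x,y\in\mathbb{R}\}$ is a copy of the complex numbers with its usual modulus. The exponential is the usual power series. The conjugations of $w=w_0+w_1\mathbf{i_1}+w_2\mathbf{i_2}+w_3\mathbf{j}$ are $w^{\dag_1}=w_0-w_1\mathbf{i_1}+w_2\mathbf{i_2}-w_3\mathbf{j}$, $w^{\dag_2}=w_0+w_1\mathbf{i_1}-w_2\mathbf{i_2}-w_3\mathbf{j}$, $w^{\dag_3}=w_0-w_1\mathbf{i_1}-w_2\mathbf{i_2}+w_3\mathbf{j}$. The idempotents are $\mathbf{e_1}=\frac{1+\mathbf{j}}{2}$, $\mathbf{e_2}=\frac{1-\mathbf{j}}{2}$; every bicomplex number has a unique expression $a\,\mathbf{e_1}+b\,\mathbf{e_2}$ with $a,b\in\mathbb{C}(\mathbf{i_1})$. Moduli: every $w\in\mathbb{T}$ can be written uniquely as $w=z_1+z_2\mathbf{i_2}$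 with $z_1,z_2\in\mathbb{C}(\mathbf{i_1})$, and uniquely as $w=u_1+u_2\mathbf{i_1}$ with $u_1,u_2\in\mathbb{C}(\mathbf{i_2})$. The usual norm is $|w|=\sqrt{|z_1|^2+|z_2|^2}$. The real moduli are $|w|_{\mathbf{1}}=|z_1^2+z_2^2|^{1/2}$, $|w|_{\mathbf{2}}=|u_1^2+u_2^2|^{1/2}$, and $|w|_{\mathbf{3}}=\big|\,|w|_{\mathbf{j}}\,\big|$, the usual norm of the number $|w|_{\mathbf{j}}=|z_1-z_2\mathbf{i_1}|\,\mathbf{e_1}+|z_1+z_2\mathbf{i_1}|\,\mathbf{e_2}$. The product $ww^{\dag_1}w^{\dag_2}w^{\dag_3}$ is always a nonnegative real number. Discrete symmetries: for $\psi=\mathrm{e}^{\alpha+\beta\mathbf{i_1}+\gamma\mathbf{i_2}+\delta\mathbf{j}}$ (here with $\delta=0$), $\hat P_n\psi$ is obtained by keeping $\alpha,\beta$ and replacing $(\gamma,\delta)$ by (products in $\mathbb{T}$): $n=0$: $(\gamma,\delta)$; $n=1$: $(-\gamma,-\delta)$; $n=2$: $(-\delta\mathbf{i_2},\gamma\mathbf{i_2})$; $n=3$: $(\delta\mathbf{i_2},-\gamma\mathbf{i_2})$; $n=4$: $(\delta\mathbf{i_1},-\gamma\mathbf{i_1})$; $n=5$: $(-\delta\mathbf{i_1},\gamma\mathbf{i_1})$; $n=6$: $(\gamma\mathbf{j},\delta\mathbf{j})$; $n=7$: $(-\gamma\mathbf{j},-\delta\mathbf{j})$. *)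

theory Defs
  imports "HOL-Analysis.Analysis"
begin

text \<open>
  \<open>BC w0 w1 w2 w3\<close> is the bicomplex number \<open>w0 + w1 i1 + w2 i2 + w3 j\<close>.
\<close>

datatype bicomplex = BC (bc0: real) (bc1: real) (bc2: real) (bc3: real)

lemma bicomplex_eqI:
  "bc0 v = bc0 w \<Longrightarrow> bc1 v = bc1 w \<Longrightarrow> bc2 v = bc2 w \<Longrightarrow> bc3 v = bc3 w \<Longrightarrow> v = w"
  by (cases v; cases w) simp

text \<open>
  Both copies of the complex numbers inside the bicomplex numbers are represented by the
  library type \<open>complex\<close>; \<open>C1\<close> and \<open>C2\<close> below are the two embeddings.  The coordinates in
  \<open>w = C1 (z1 w) + C1 (z2 w) i2\<close> and \<open>w = C2 (u1 w) + C2 (u2 w) i1\<close> are as follows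
  (see the lemmas \<open>bc_z_decomp\<close> and \<open>bc_u_decomp\<close>).
\<close>

definition bc_z1 :: "bicomplex \<Rightarrow> complex" where "bc_z1 w = Complex (bc0 w) (bc1 w)"
definition bc_z2 :: "bicomplex \<Rightarrow> complex" where "bc_z2 w = Complex (bc2 w) (bc3 w)"
definition bc_u1 :: "bicomplex \<Rightarrow> complex" where "bc_u1 w = Complex (bc0 w) (bc2 w)"
definition bc_u2 :: "bicomplex \<Rightarrow> complex" where "bc_u2 w = Complex (bc1 w) (bc3 w)"

instantiation bicomplex :: comm_ring_1
begin

definition "0 = BC 0 0 0 0"
definition "1 = BC 1 0 0 0"
definition "- w = BC (- bc0 w) (- bc1 w) (- bc2 w) (- bc3 w)"
definition "v + w = BC (bc0 v + bc0 w) (bc1 v + bc1 w) (bc2 v + bc2 w) (bc3 v + bc3 w)"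
definition "v - w = BC (bc0 v - bc0 w) (bc1 v - bc1 w) (bc2 v - bc2 w) (bc3 v - bc3 w)"
definition "v * w = BC
  (bc0 v * bc0 w - bc1 v * bc1 w - bc2 v * bc2 w + bc3 v * bc3 w)
  (bc0 v * bc1 w + bc1 v * bc0 w - bc2 v * bc3 w - bc3 v * bc2 w)
  (bc0 v * bc2 w + bc2 v * bc0 w - bc1 v * bc3 w - bc3 v * bc1 w)
  (bc0 v * bc3 w + bc3 v * bc0 w + bc1 v * bc2 w + bc2 v * bc1 w)"

instance
  by standard
    (simp_all add: zero_bicomplex_def one_bicomplex_def uminus_bicomplex_def plus_bicomplex_def
      minus_bicomplex_def times_bicomplex_def algebra_simps)

end

instantiation bicomplex :: real_algebra_1
begin

definition "r *\<^sub>R w = BC (r * bc0 w) (r * bc1 w) (r * bc2 w) (r * bc3 w)"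

instance
  by standard
    (simp_all add: scaleR_bicomplex_def plus_bicomplex_def times_bicomplex_def algebra_simps)

end

lemmas bicomplex_ring_defs =
  zero_bicomplex_def one_bicomplex_def uminus_bicomplex_def plus_bicomplex_def
  minus_bicomplex_def times_bicomplex_def scaleR_bicomplex_def

text \<open>
  The usual norm is not submultiplicative, so the type is made a normed vector space, but
  not a \<open>real_normed_algebra\<close>; in particular the library function \<open>exp\<close> does not apply.
\<close>

instantiation bicomplex :: real_normed_vector
begin

definition "norm w = sqrt ((cmod (bc_z1 w))\<^sup>2 + (cmod (bc_z2 w))\<^sup>2)"
definition "sgn (w :: bicomplex) = w /\<^sub>R norm w"
definition "dist v w = norm (v - w :: bicomplex)"
definition "uniformity = (INF e\<in>{0<..}. principal {(v :: bicomplex, w). dist v w < e})"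
definition "open (U :: bicomplex set) =
  (\<forall>w\<in>U. eventually (\<lambda>(w', v). w' = w \<longrightarrow> v \<in> U) uniformity)"

instance
proof
  have norm_eq: "norm w = norm (bc_z1 w, bc_z2 w)" for w
    by (simp add: norm_bicomplex_def norm_Pair)
  fix v w :: bicomplex and r :: real
  show "(norm w = 0) = (w = 0)"
    unfolding norm_eq norm_eq_zero
    by (cases w) (simp add: bc_z1_def bc_z2_def bicomplex_ring_defs zero_prod_def complex_eq_iff)
  have "norm (v + w) = norm ((bc_z1 v, bc_z2 v) + (bc_z1 w, bc_z2 w))"
    unfolding norm_eq by (simp add: bc_z1_def bc_z2_def bicomplex_ring_defs complex_add)
  then show "norm (v + w) \<le> norm v + norm w"
    unfolding norm_eq by (metis norm_triangle_ineq)
  have "norm (r *\<^sub>R w) = norm (r *\<^sub>R (bc_z1 w, bc_z2 w))"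
    unfolding norm_eq by (simp add: bc_z1_def bc_z2_def bicomplex_ring_defs scaleR_complex.code)
  then show "norm (r *\<^sub>R w) = \<bar>r\<bar> * norm w"
    unfolding norm_eq by (metis norm_scaleR)
qed (rule sgn_bicomplex_def dist_bicomplex_def uniformity_bicomplex_def open_bicomplex_def)+

end

definition bc_i1 :: bicomplex where "bc_i1 = BC 0 1 0 0"
definition bc_i2 :: bicomplex where "bc_i2 = BC 0 0 1 0"
definition bc_j :: bicomplex where "bc_j = BC 0 0 0 1"

definition C1 :: "complex \<Rightarrow> bicomplex" where
  "C1 z = of_real (Re z) + of_real (Im z) * bc_i1"
definition C2 :: "complex \<Rightarrow> bicomplex" where
  "C2 z = of_real (Re z) + of_real (Im z) * bc_i2"

definition bc_e1 :: bicomplex where "bc_e1 = (1 / 2) *\<^sub>R (1 + bc_j)"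
definition bc_e2 :: bicomplex where "bc_e2 = (1 / 2) *\<^sub>R (1 - bc_j)"

lemma bc_of_real: "of_real r = BC r 0 0 0"
  by (simp add: of_real_def bicomplex_ring_defs)

lemmas bicomplex_defs =
  bicomplex_ring_defs bc_of_real bc_i1_def bc_i2_def bc_j_def C1_def C2_def bc_e1_def bc_e2_def
  bc_z1_def bc_z2_def bc_u1_def bc_u2_def

lemma bc_unit_products:
  "bc_i1 * bc_i1 = -1" "bc_i2 * bc_i2 = -1" "bc_j * bc_j = 1"
  "bc_i1 * bc_i2 = bc_j" "bc_i1 * bc_j = - bc_i2" "bc_i2 * bc_j = - bc_i1"
  by (simp_all add: bicomplex_defs)

lemma bc_expand:
  "BC w0 w1 w2 w3 =
    of_real w0 + of_real w1 * bc_i1 + of_real w2 * bc_i2 + of_real w3 * bc_j"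
  by (simp add: bicomplex_defs)

lemma bc_z_decomp: "w = C1 a + C1 b * bc_i2 \<longleftrightarrow> a = bc_z1 w \<and> b = bc_z2 w"
  by (cases w; cases a; cases b) (auto simp: bicomplex_defs)

lemma bc_u_decomp: "w = C2 a + C2 b * bc_i1 \<longleftrightarrow> a = bc_u1 w \<and> b = bc_u2 w"
  by (cases w; cases a; cases b) (auto simp: bicomplex_defs)

lemma bc_idempotent_decomp:
  "w = C1 a * bc_e1 + C1 b * bc_e2 \<longleftrightarrow>
    a = bc_z1 w - bc_z2 w * \<i> \<and> b = bc_z1 w + bc_z2 w * \<i>"
  by (cases w; cases a; cases b) (auto simp: bicomplex_defs complex_eq_iff field_simps)

definition bc_conj1 :: "bicomplex \<Rightarrow> bicomplex" where
  "bc_conj1 w = BC (bc0 w) (- bc1 w) (bc2 w) (- bc3 w)"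
definition bc_conj2 :: "bicomplex \<Rightarrow> bicomplex" where
  "bc_conj2 w = BC (bc0 w) (bc1 w) (- bc2 w) (- bc3 w)"
definition bc_conj3 :: "bicomplex \<Rightarrow> bicomplex" where
  "bc_conj3 w = BC (bc0 w) (- bc1 w) (- bc2 w) (bc3 w)"

definition bc_mod1 :: "bicomplex \<Rightarrow> real" where
  "bc_mod1 w = sqrt (cmod ((bc_z1 w)\<^sup>2 + (bc_z2 w)\<^sup>2))"
definition bc_mod2 :: "bicomplex \<Rightarrow> real" where
  "bc_mod2 w = sqrt (cmod ((bc_u1 w)\<^sup>2 + (bc_u2 w)\<^sup>2))"
definition bc_modj :: "bicomplex \<Rightarrow> bicomplex" where
  "bc_modj w = of_real (cmod (bc_z1 w - bc_z2 w * \<i>)) * bc_e1 +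
               of_real (cmod (bc_z1 w + bc_z2 w * \<i>)) * bc_e2"
definition bc_mod3 :: "bicomplex \<Rightarrow> real" where
  "bc_mod3 w = norm (bc_modj w)"

text \<open>
  The product of \<open>w\<close> with its three conjugates is a nonnegative real number, so nothing is
  lost by reading it off as the real coordinate \<open>bc0\<close>.
\<close>

definition bc_conj_product :: "bicomplex \<Rightarrow> bicomplex" where
  "bc_conj_product w = w * bc_conj1 w * bc_conj2 w * bc_conj3 w"

lemma bc_conj_product_real:
  "bc_conj_product w = of_real (bc0 (bc_conj_product w))" "bc0 (bc_conj_product w) \<ge> 0"
proof -
  obtain a b c d where w: "w = BC a b c d" by (cases w)
  have eq: "bc_conj_product w =
      BC ((a * a + c * c - b * b - d * d)\<^sup>2 + (2 * (a * b + c * d))\<^sup>2) 0 0 0"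
    by (simp add: w bc_conj_product_def bc_conj1_def bc_conj2_def bc_conj3_def
        times_bicomplex_def) (simp add: power2_eq_square algebra_simps)
  show "bc_conj_product w = of_real (bc0 (bc_conj_product w))"
    by (simp add: eq bc_of_real)
  show "bc0 (bc_conj_product w) \<ge> 0"
    by (simp add: eq)
qed

definition bc_exp :: "bicomplex \<Rightarrow> bicomplex" where
  "bc_exp w = (\<Sum>n. w ^ n /\<^sub>R fact n)"

lemma bc_exp_summable: "summable (\<lambda>n. (w :: bicomplex) ^ n /\<^sub>R fact n)"
proof -
  define L :: "complex \<times> complex \<Rightarrow> bicomplex"
    where "L = (\<lambda>p. C1 (fst p) * bc_e1 + C1 (snd p) * bc_e2)"
  have add: "L (p + q) = L p + L q" for p q
    by (simp add: L_def bicomplex_defs field_simps)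
  have scale: "L (r *\<^sub>R p) = r *\<^sub>R L p" for r p
    by (simp add: L_def bicomplex_defs field_simps)
  have mult: "L p * L q = L (fst p * fst q, snd p * snd q)" for p q
    by (simp add: L_def bicomplex_defs field_simps)
  have "linear L"
    by (rule linearI) (fact add scale)+
  then have bl: "bounded_linear L"
    by (simp add: linear_conv_bounded_linear)
  obtain a b where w: "w = L (a, b)"
    using bc_idempotent_decomp[of w] by (auto simp: L_def)
  have pow: "w ^ n = L (a ^ n, b ^ n)" for n
  proof (induction n)
    case 0
    show ?case by (simp add: L_def bicomplex_defs)
  next
    case (Suc n)
    then show ?case by (simp add: w mult)
  qed
  have "(\<lambda>n. (a ^ n /\<^sub>R fact n, b ^ n /\<^sub>R fact n)) sums (exp a, exp b)"
    unfolding sums_def by (simp add: sum_prod exp_converges[unfolded sums_def] tendsto_Pair)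
  then have "(\<lambda>n. L (a ^ n /\<^sub>R fact n, b ^ n /\<^sub>R fact n)) sums L (exp a, exp b)"
    by (rule bounded_linear.sums[OF bl])
  moreover have "L (a ^ n /\<^sub>R fact n, b ^ n /\<^sub>R fact n) = w ^ n /\<^sub>R fact n" for n
    using scale[of "inverse (fact n)" "(a ^ n, b ^ n)"] by (simp add: pow)
  ultimately show ?thesis
    by (simp add: sums_iff)
qed

text \<open>
  The wave function with exponent \<open>\<alpha> + \<beta> i1 + \<gamma> i2 + \<delta> j\<close>; the coefficients \<open>\<gamma>\<close> and \<open>\<delta>\<close>
  are allowed to be bicomplex because the symmetries replace them by multiples of the units.
\<close>

definition bc_wave :: "real \<Rightarrow> real \<Rightarrow> bicomplex \<times> bicomplex \<Rightarrow> bicomplex" where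
  "bc_wave \<alpha> \<beta> = (\<lambda>(\<gamma>, \<delta>).
     bc_exp (of_real \<alpha> + of_real \<beta> * bc_i1 + \<gamma> * bc_i2 + \<delta> * bc_j))"

text \<open>Only the indices \<open>n = 0, \<dots>, 7\<close> are meaningful.\<close>

definition sym_subst :: "nat \<Rightarrow> bicomplex \<Rightarrow> bicomplex \<Rightarrow> bicomplex \<times> bicomplex" where
  "sym_subst n \<gamma> \<delta> =
    [(\<gamma>, \<delta>),
     (- \<gamma>, - \<delta>),
     (- \<delta> * bc_i2, \<gamma> * bc_i2),
     (\<delta> * bc_i2, - \<gamma> * bc_i2),
     (\<delta> * bc_i1, - \<gamma> * bc_i1),
     (- \<delta> * bc_i1, \<gamma> * bc_i1),
     (\<gamma> * bc_j, \<delta> * bc_j),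
     (- \<gamma> * bc_j, - \<delta> * bc_j)] ! n"

text \<open>
  The symmetry acts through the exponent, so it is indexed by the four real coefficient
  functions of the wave function.
\<close>

definition P_hat :: "nat \<Rightarrow> (real \<times> real \<Rightarrow> real) \<Rightarrow> (real \<times> real \<Rightarrow> real) \<Rightarrow>
    (real \<times> real \<Rightarrow> real) \<Rightarrow> (real \<times> real \<Rightarrow> real) \<Rightarrow> real \<times> real \<Rightarrow> bicomplex" where
  "P_hat n \<alpha> \<beta> \<gamma> \<delta> = (\<lambda>p.
     bc_wave (\<alpha> p) (\<beta> p) (sym_subst n (of_real (\<gamma> p)) (of_real (\<delta> p))))"

end

theory Submission
  imports Defs
begin

text \<open>
  In the idempotent coordinates \<open>w = a e1 + b e2\<close> the ring operations, and hence the exponential,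
  act componentwise, and each of the moduli depends only on \<open>|a|\<close> and \<open>|b|\<close>: it is either
  a quadratic or a geometric mean of the two.  For the exponent \<open>\<alpha> + \<beta> i1 + \<gamma> i2\<close> the components
  are \<open>exp (\<alpha> + (\<beta> \<mp> \<gamma>) i1)\<close>, both of modulus \<open>exp \<alpha>\<close>, so all these means agree.
  With \<open>\<delta> = 0\<close> every symmetry yields an exponent \<open>\<alpha> + \<beta>' i1 + \<gamma>' i2\<close> with real \<open>\<beta>'\<close>, \<open>\<gamma>'\<close>.
\<close>

text \<open>Taking a pair as argument makes this a linear map between normed spaces, so convergent
  series can be transported along it.\<close>

definition bc_idem :: "complex \<times> complex \<Rightarrow> bicomplex" where
  "bc_idem p = C1 (fst p) * bc_e1 + C1 (snd p) * bc_e2"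

lemma bc_idem_coords:
  "bc_idem (a, b) = BC ((Re a + Re b) / 2) ((Im a + Im b) / 2)
     ((Im b - Im a) / 2) ((Re a - Re b) / 2)"
  by (simp add: bc_idem_def bicomplex_defs field_simps)

lemma bc_idem_eq_iff: "bc_idem p = bc_idem q \<longleftrightarrow> p = q"
  by (cases p; cases q) (auto simp: bc_idem_coords complex_eq_iff)

text \<open>\<open>bc_e1\<close> and \<open>bc_e2\<close> are idempotent with product 0, so the
  mixed terms vanish.\<close>

lemma bc_idem_mult: "bc_idem (a, b) * bc_idem (c, d) = bc_idem (a * c, b * d)"
  by (simp add: bc_idem_coords times_bicomplex_def field_simps)

lemma bc_idem_power: "bc_idem (a, b) ^ n = bc_idem (a ^ n, b ^ n)"
proof (induction n)
  case 0
  show ?case by (simp add: bc_idem_coords one_bicomplex_def)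
next
  case (Suc n)
  then show ?case by (simp add: bc_idem_mult)
qed

lemma bc_idem_scaleR: "bc_idem (r *\<^sub>R p) = r *\<^sub>R bc_idem p"
  by (cases p) (simp add: bc_idem_coords scaleR_bicomplex_def field_simps)

lemma bounded_linear_bc_idem: "bounded_linear bc_idem"
proof -
  have "bc_idem (p + q) = bc_idem p + bc_idem q" for p q
    by (cases p; cases q) (simp add: bc_idem_coords plus_bicomplex_def field_simps)
  then have "linear bc_idem"
    by (intro linearI bc_idem_scaleR)
  \<comment> \<open>Boundedness is automatic because the domain is finite-dimensional.\<close>
  then show ?thesis
    by (simp add: linear_conv_bounded_linear)
qed

text \<open>The two complex exponential series converge jointly, and the bounded linear map
  \<open>bc_idem\<close> carries their partial sums to those of \<open>bc_exp\<close>.\<close>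

lemma bc_exp_idem: "bc_exp (bc_idem (a, b)) = bc_idem (exp a, exp b)"
proof -
  have "(\<lambda>n. (a ^ n /\<^sub>R fact n, b ^ n /\<^sub>R fact n)) sums (exp a, exp b)"
    unfolding sums_def by (simp add: sum_prod exp_converges[unfolded sums_def] tendsto_Pair)
  from bounded_linear.sums[OF bounded_linear_bc_idem this]
  have "(\<lambda>n. bc_idem (a, b) ^ n /\<^sub>R fact n) sums bc_idem (exp a, exp b)"
    by (simp add: bc_idem_power flip: bc_idem_scaleR)
  then show ?thesis
    by (simp add: bc_exp_def sums_iff)
qed

text \<open>This is the parallelogram law for a = z1 - z2 i and b = z1 + z2 i.\<close>

lemma norm_bc_idem: "(norm (bc_idem (a, b)))\<^sup>2 = ((cmod a)\<^sup>2 + (cmod b)\<^sup>2) / 2"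
  by (simp add: norm_bicomplex_def bc_idem_coords bc_z1_def bc_z2_def cmod_power2)
    (simp add: power2_eq_square field_simps)

lemma bc_mod1_idem: "(bc_mod1 (bc_idem (a, b)))\<^sup>2 = cmod a * cmod b"
proof -
  \<comment> \<open>The sum of squares factors as (z1 - z2 i)(z1 + z2 i).\<close>
  have "(bc_z1 (bc_idem (a, b)))\<^sup>2 + (bc_z2 (bc_idem (a, b)))\<^sup>2 = a * b"
    by (simp add: bc_idem_coords bc_z1_def bc_z2_def complex_eq_iff power2_eq_square field_simps)
  then show ?thesis
    by (simp add: bc_mod1_def norm_mult)
qed

lemma bc_mod2_idem: "(bc_mod2 (bc_idem (a, b)))\<^sup>2 = cmod a * cmod b"
proof -
  \<comment> \<open>The same factorization, with u1 - u2 i = \<open>cnj a\<close> and u1 + u2 i =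
    \<open>b\<close>: multiplication by \<open>bc_i2\<close> agrees with that by
    \<open>- bc_i1\<close> on \<open>bc_e1\<close> and by \<open>bc_i1\<close> on
    \<open>bc_e2\<close>, so only the first component is conjugated.\<close>
  have "(bc_u1 (bc_idem (a, b)))\<^sup>2 + (bc_u2 (bc_idem (a, b)))\<^sup>2 = cnj a * b"
    by (simp add: bc_idem_coords bc_u1_def bc_u2_def complex_eq_iff power2_eq_square field_simps)
  then show ?thesis
    by (simp add: bc_mod2_def norm_mult)
qed

lemma bc_mod3_idem: "(bc_mod3 (bc_idem (a, b)))\<^sup>2 = ((cmod a)\<^sup>2 + (cmod b)\<^sup>2) / 2"
proof -
  have "a = bc_z1 (bc_idem (a, b)) - bc_z2 (bc_idem (a, b)) * \<i> \<and>
        b = bc_z1 (bc_idem (a, b)) + bc_z2 (bc_idem (a, b)) * \<i>"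
    by (simp add: bc_idem_def flip: bc_idempotent_decomp)
  then have "bc_modj (bc_idem (a, b)) = bc_idem (of_real (cmod a), of_real (cmod b))"
    by (simp add: bc_modj_def bc_idem_def C1_def)
  then show ?thesis
    by (simp add: bc_mod3_def norm_bc_idem)
qed

lemma bc_conj_product_idem: "sqrt (bc0 (bc_conj_product (bc_idem (a, b)))) = cmod a * cmod b"
proof -
  \<comment> \<open>The first two conjugations negate \<open>bc_j\<close> and so exchange the
    idempotents; the first and third negate \<open>bc_i1\<close> and so conjugate the
    components.\<close>
  have conj: "bc_conj1 (bc_idem (a, b)) = bc_idem (cnj b, cnj a)"
    "bc_conj2 (bc_idem (a, b)) = bc_idem (b, a)"
    "bc_conj3 (bc_idem (a, b)) = bc_idem (cnj a, cnj b)"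
    by (simp_all add: bc_idem_coords bc_conj1_def bc_conj2_def bc_conj3_def field_simps)
  have "a * cnj b * b * cnj a = of_real ((cmod a * cmod b)\<^sup>2)"
    "b * cnj a * a * cnj b = of_real ((cmod a * cmod b)\<^sup>2)"
    using complex_norm_square[of a] complex_norm_square[of b]
    by (simp_all add: power_mult_distrib mult_ac)
  then have "bc_conj_product (bc_idem (a, b)) =
      bc_idem (of_real ((cmod a * cmod b)\<^sup>2), of_real ((cmod a * cmod b)\<^sup>2))"
    by (simp only: bc_conj_product_def conj bc_idem_mult)
  then show ?thesis
    by (simp add: bc_idem_coords del: of_real_power of_real_mult)
qed

lemma bc_exp_no_j:
  "bc_exp (of_real \<alpha> + of_real \<beta> * bc_i1 + of_real \<gamma> * bc_i2) =
    bc_idem (exp (Complex \<alpha> (\<beta> - \<gamma>)), exp (Complex \<alpha> (\<beta> + \<gamma>)))"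
proof -
  have "of_real \<alpha> + of_real \<beta> * bc_i1 + of_real \<gamma> * bc_i2 =
      bc_idem (Complex \<alpha> (\<beta> - \<gamma>), Complex \<alpha> (\<beta> + \<gamma>))"
    by (simp add: bc_idem_coords bicomplex_defs)
  then show ?thesis
    by (simp add: bc_exp_idem)
qed

text \<open>The coefficients \<beta> and \<gamma> affect only the phases of the two components.
  Hence a symmetry that alters only these two real coefficients preserves the norm.\<close>

lemma norm_bc_exp_no_j:
  "norm (bc_exp (of_real \<alpha> + of_real \<beta> * bc_i1 + of_real \<gamma> * bc_i2)) = exp \<alpha>"
proof -
  have "(norm (bc_exp (of_real \<alpha> + of_real \<beta> * bc_i1 + of_real \<gamma> * bc_i2)))\<^sup>2 = (exp \<alpha>)\<^sup>2"
    by (simp add: bc_exp_no_j norm_bc_idem)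
  then show ?thesis
    by (simp add: power2_eq_iff_nonneg)
qed

lemma P_hat_exponent:
  assumes "n \<le> 7"
  shows "\<exists>b c. P_hat n \<alpha> \<beta> \<gamma> (\<lambda>_. 0) p =
    bc_exp (of_real (\<alpha> p) + of_real b * bc_i1 + of_real c * bc_i2)"
proof -
  define g :: bicomplex where "g = of_real (\<gamma> p)"
  obtain b c where "fst (sym_subst n g 0) * bc_i2 + snd (sym_subst n g 0) * bc_j =
      of_real b * bc_i1 + of_real c * bc_i2"
  proof -
    \<comment> \<open>With \<delta> = 0, the first group turns the \<gamma> term into plus or minus
      \<gamma> times \<open>bc_i2\<close>, the second into plus or minus \<gamma> times
      \<open>bc_i1\<close>.\<close>
    have "n \<in> {0, 1, 4, 5} \<or> n \<in> {2, 3, 6, 7}"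
      using assms by auto
    then have "\<exists>b c. fst (sym_subst n g 0) * bc_i2 + snd (sym_subst n g 0) * bc_j =
        of_real b * bc_i1 + of_real c * bc_i2"
    proof
      assume "n \<in> {0, 1, 4, 5}"
      then have "\<exists>c\<in>{\<gamma> p, - \<gamma> p}. fst (sym_subst n g 0) * bc_i2 + snd (sym_subst n g 0) * bc_j =
          of_real 0 * bc_i1 + of_real c * bc_i2"
        by (auto simp: sym_subst_def g_def bicomplex_defs)
      then show ?thesis by blast
    next
      assume "n \<in> {2, 3, 6, 7}"
      then have "\<exists>b\<in>{\<gamma> p, - \<gamma> p}. fst (sym_subst n g 0) * bc_i2 + snd (sym_subst n g 0) * bc_j =
          of_real b * bc_i1 + of_real 0 * bc_i2"
        by (auto simp: sym_subst_def g_def bicomplex_defs)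
      then show ?thesis by blast
    qed
    then show ?thesis using that by blast
  qed
  \<comment> \<open>The new \<open>bc_i1\<close> contribution is absorbed into the coefficient
    \<beta>.\<close>
  then have "P_hat n \<alpha> \<beta> \<gamma> (\<lambda>_. 0) p =
      bc_exp (of_real (\<alpha> p) + of_real (\<beta> p + b) * bc_i1 + of_real c * bc_i2)"
    by (simp add: P_hat_def bc_wave_def g_def case_prod_unfold algebra_simps)
  then show ?thesis by blast
qed

theorem corollary1:
  fixes \<alpha> \<beta> \<gamma> :: "real \<times> real \<Rightarrow> real"
    and \<psi> :: "real \<times> real \<Rightarrow> bicomplex"
    and \<psi>\<^sub>p \<psi>\<^sub>m :: "real \<times> real \<Rightarrow> complex"
  assumes wave: "\<And>x t. \<psi> (x, t) =
      bc_exp (of_real (\<alpha> (x, t)) + of_real (\<beta> (x, t)) * bc_i1 + of_real (\<gamma> (x, t)) * bc_i2)"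
    and idempotent: "\<And>x t. \<psi> (x, t) = C1 (\<psi>\<^sub>p (x, t)) * bc_e1 + C1 (\<psi>\<^sub>m (x, t)) * bc_e2"
  shows "(\<forall>x t.
      (norm (\<psi> (x, t)))\<^sup>2 = (bc_mod1 (\<psi> (x, t)))\<^sup>2 \<and>
      (bc_mod1 (\<psi> (x, t)))\<^sup>2 = (bc_mod2 (\<psi> (x, t)))\<^sup>2 \<and>
      (bc_mod2 (\<psi> (x, t)))\<^sup>2 = (bc_mod3 (\<psi> (x, t)))\<^sup>2 \<and>
      (bc_mod3 (\<psi> (x, t)))\<^sup>2 = sqrt (bc0 (bc_conj_product (\<psi> (x, t)))) \<and>
      sqrt (bc0 (bc_conj_product (\<psi> (x, t)))) =
        ((cmod (\<psi>\<^sub>p (x, t)))\<^sup>2 + (cmod (\<psi>\<^sub>m (x, t)))\<^sup>2) / 2 \<and>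
      ((cmod (\<psi>\<^sub>p (x, t)))\<^sup>2 + (cmod (\<psi>\<^sub>m (x, t)))\<^sup>2) / 2 = exp (2 * \<alpha> (x, t))) \<and>
    (\<forall>n \<le> 7. \<forall>x t. (norm (P_hat n \<alpha> \<beta> \<gamma> (\<lambda>_. 0) (x, t)))\<^sup>2 = (norm (\<psi> (x, t)))\<^sup>2)"
proof (intro conjI allI impI)
  fix x t
  define E where "E = exp (\<alpha> (x, t))"
  have \<psi>: "\<psi> (x, t) = bc_idem (\<psi>\<^sub>p (x, t), \<psi>\<^sub>m (x, t))"
    by (simp add: idempotent bc_idem_def)
  \<comment> \<open>Uniqueness of the idempotent decomposition identifies the given components with
    the two exponentials.\<close>
  then have "(\<psi>\<^sub>p (x, t), \<psi>\<^sub>m (x, t)) =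
      (exp (Complex (\<alpha> (x, t)) (\<beta> (x, t) - \<gamma> (x, t))), exp (Complex (\<alpha> (x, t)) (\<beta> (x, t) + \<gamma> (x, t))))"
    using wave[of x t] by (simp only: bc_exp_no_j bc_idem_eq_iff)
  then have mods: "cmod (\<psi>\<^sub>p (x, t)) = E" "cmod (\<psi>\<^sub>m (x, t)) = E"
    by (simp_all add: E_def)
  \<comment> \<open>With equal component moduli, the mean of the squares and the product are both
    the square of \<open>E\<close>.\<close>
  show "(norm (\<psi> (x, t)))\<^sup>2 = (bc_mod1 (\<psi> (x, t)))\<^sup>2"
    "(bc_mod1 (\<psi> (x, t)))\<^sup>2 = (bc_mod2 (\<psi> (x, t)))\<^sup>2"
    "(bc_mod2 (\<psi> (x, t)))\<^sup>2 = (bc_mod3 (\<psi> (x, t)))\<^sup>2"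
    "(bc_mod3 (\<psi> (x, t)))\<^sup>2 = sqrt (bc0 (bc_conj_product (\<psi> (x, t))))"
    "sqrt (bc0 (bc_conj_product (\<psi> (x, t)))) =
      ((cmod (\<psi>\<^sub>p (x, t)))\<^sup>2 + (cmod (\<psi>\<^sub>m (x, t)))\<^sup>2) / 2"
    by (simp_all add: \<psi> mods norm_bc_idem bc_mod1_idem bc_mod2_idem bc_mod3_idem
        bc_conj_product_idem flip: power2_eq_square)
  show "((cmod (\<psi>\<^sub>p (x, t)))\<^sup>2 + (cmod (\<psi>\<^sub>m (x, t)))\<^sup>2) / 2 = exp (2 * \<alpha> (x, t))"
    by (simp add: mods E_def exp_double)
next
  fix n :: nat and x t
  assume "n \<le> 7"
  then obtain b c where "P_hat n \<alpha> \<beta> \<gamma> (\<lambda>_. 0) (x, t) =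
      bc_exp (of_real (\<alpha> (x, t)) + of_real b * bc_i1 + of_real c * bc_i2)"
    using P_hat_exponent by blast
  \<comment> \<open>Both exponents have the same \<alpha>, which alone determines the norm.\<close>
  then show "(norm (P_hat n \<alpha> \<beta> \<gamma> (\<lambda>_. 0) (x, t)))\<^sup>2 = (norm (\<psi> (x, t)))\<^sup>2"
    by (simp add: wave norm_bc_exp_no_j)
qed

end
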